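(* The penalty $\mathrm{Pen}(\mathcal{T}_{\mathrm{blind}}^{\mathrm{nodist}}/\mathcal{T}_{\mathrm{comp}}^{\mathrm{nodist}})$ is $O(1)$.
   Context: Treasure hunt in trees. A tree is a finite tree rooted at the starting node of a mobile agent; at each node of degree $\delta$ the incident edges carry port numbers $0,\dots,\delta-1$, assigned arbitrarily at each node. $h(T)$ is the depth of $T$. An instance is a pair $(T,d)$ with $T$ a tree and $1\le d\le h(T)$; a knowledge is a set of instances. For a tree $T^*$, let $P(T^* )$ be the set of trees obtained from $T^*$ by reassigning arbitrary port numbers at each node. $\mathcal{T}_{\mathrm{comp}}^{\mathrm{nodist}}$ is the family of all knowledges $\{(T^*,d):1\le d\le h(T^* )\}$ and $\mathcal{T}_{\mathrm{blind}}^{\mathrm{nodist}}$ the family of all knowledges $\{(T,d): T\in P(T^* ),1\le d\le h(T^* )\}$, over all trees $T^*$. A deterministic algorithm given knowledge $K$ starts at the root; at each step it sees the port numbers at its current node, chooses one based on its history (initially $K$), traverses the edge and learns the entry port and degree of the new node. The cost $C_{\mathcal{A}}^K(T,d)$ is the number of edge traversals (including revisits) by $\mathcal{A}$ in $T$ until all nodes at distance exactly $d$ from the root are visited. With $B_m(K)=\{(T,d)\in K:d\le m\}$, the overhead is $\mathcal{O}_{\mathcal{A}}^K(m)=\max_{(T,d)\in B_m(K)}C_{\mathcal{A}}^K(T,d)/d$ if $B_m(K)\ne\emptyset$, else $0$. For knowledge types $\mathcal{T}_1\ll\mathcal{T}_2$ (every $K_1\in\mathcal{T}_1$ is contained in some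 $K_2\in\mathcal{T}_2$) and $f:\mathbb{N}\to\mathbb{N}$, $\mathrm{Pen}(\mathcal{T}_2/\mathcal{T}_1)$ is $O(f)$ if there exist a constant $c>0$ and a deterministic algorithm $\mathcal{A}_2$ such that for every deterministic algorithm $\mathcal{A}_1$, for all $K_2\in\mathcal{T}_2$ and all $m\ge1$: $\mathcal{O}_{\mathcal{A}_2}^{K_2}(m)\le c\cdot f(m)\cdot\max_{K_1\in\mathcal{T}_1,K_1\subseteq K_2}\mathcal{O}_{\mathcal{A}_1}^{K_1}(m)$. $O(1)$ means $O(f)$ for a constant function $f$. *)

theory Defs
  imports "HOL-Library.Extended_Nonnegative_Real" "HOL-Library.FuncSet"
begin

text \<open>
  \<open>port T v u\<close> is the port number, at node \<open>v\<close>, of the edge between \<open>v\<close> and \<open>u\<close>.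
  Natural numbers serve as node names; they are not visible to the agent.
\<close>

record ptree =
  nodes :: "nat set"
  edges :: "nat set set"
  start :: nat
  port :: "nat \<Rightarrow> nat \<Rightarrow> nat"

definition adj :: "ptree \<Rightarrow> nat \<Rightarrow> nat \<Rightarrow> bool" where
  "adj T u v \<longleftrightarrow> {u, v} \<in> edges T"

definition nbrs :: "ptree \<Rightarrow> nat \<Rightarrow> nat set" where
  "nbrs T v = {u. adj T v u}"

definition degree :: "ptree \<Rightarrow> nat \<Rightarrow> nat" where
  "degree T v = card (nbrs T v)"

definition has_cycle :: "ptree \<Rightarrow> bool" where
  "has_cycle T \<longleftrightarrow>
     (\<exists>p. length p \<ge> 3 \<and> distinct p \<and> successively (adj T) p \<and> adj T (last p) (hd p))"

text \<open>
  Extensionality only fixes the irrelevant values of \<open>port\<close> at pairs of non-adjacent nodes,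
  so that a port numbering is represented by exactly one function.
\<close>

definition is_tree :: "ptree \<Rightarrow> bool" where
  "is_tree T \<longleftrightarrow>
     finite (nodes T) \<and> start T \<in> nodes T \<and>
     edges T \<subseteq> {{u, v} |u v. u \<in> nodes T \<and> v \<in> nodes T \<and> u \<noteq> v} \<and>
     (\<forall>u\<in>nodes T. \<forall>v\<in>nodes T. (adj T)\<^sup>*\<^sup>* u v) \<and>
     \<not> has_cycle T \<and>
     (\<forall>v\<in>nodes T. bij_betw (port T v) (nbrs T v) {..<degree T v}) \<and>
     (\<forall>v. port T v \<in> extensional (nbrs T v))"

definition depth :: "ptree \<Rightarrow> nat \<Rightarrow> nat" where
  "depth T v = (LEAST n. (adj T ^^ n) (start T) v)"

definition level :: "ptree \<Rightarrow> nat \<Rightarrow> nat set" where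
  "level T d = {v \<in> nodes T. depth T v = d}"

definition height :: "ptree \<Rightarrow> nat" where
  "height T = Max (depth T ` nodes T)"

definition port_reassignments :: "ptree \<Rightarrow> ptree set" where
  "port_reassignments T =
     {T'. is_tree T' \<and> nodes T' = nodes T \<and> edges T' = edges T \<and> start T' = start T}"

type_synonym knowledge = "(ptree \<times> nat) set"

definition comp_nodist :: "knowledge set" where
  "comp_nodist = {{(T, d) |d. 1 \<le> d \<and> d \<le> height T} |T. is_tree T}"

definition blind_nodist :: "knowledge set" where
  "blind_nodist =
     {{(T', d) |T' d. T' \<in> port_reassignments T \<and> 1 \<le> d \<and> d \<le> height T} |T. is_tree T}"

text \<open>
  A history (apart from the initial knowledge) consists of the degree of the starting node and
  the chronological list of all moves, each recorded as the triple of the port taken, the entry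
  port, and the degree of the node entered.
\<close>

type_synonym history = "nat \<times> (nat \<times> nat \<times> nat) list"

definition current_degree :: "history \<Rightarrow> nat" where
  "current_degree H = (if snd H = [] then fst H else snd (snd (last (snd H))))"

type_synonym algorithm = "knowledge \<Rightarrow> history \<Rightarrow> nat"

definition det_algorithm :: "algorithm \<Rightarrow> bool" where
  "det_algorithm A \<longleftrightarrow> (\<forall>K H. current_degree H > 0 \<longrightarrow> A K H < current_degree H)"

definition via_port :: "ptree \<Rightarrow> nat \<Rightarrow> nat \<Rightarrow> nat" where
  "via_port T v p = (THE u. u \<in> nbrs T v \<and> port T v u = p)"

primrec run :: "algorithm \<Rightarrow> knowledge \<Rightarrow> ptree \<Rightarrow> nat \<Rightarrow> nat \<times> history" where
  "run A K T 0 = (start T, (degree T (start T), []))"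
| "run A K T (Suc n) =
     (case run A K T n of (v, H) \<Rightarrow>
        let p = A K H; u = via_port T v p
        in (u, (fst H, snd H @ [(p, port T u v, degree T u)])))"

definition position :: "algorithm \<Rightarrow> knowledge \<Rightarrow> ptree \<Rightarrow> nat \<Rightarrow> nat" where
  "position A K T n = fst (run A K T n)"

text \<open>The cost is infinite if some node at distance \<open>d\<close> is never visited.\<close>

definition cost :: "algorithm \<Rightarrow> knowledge \<Rightarrow> ptree \<Rightarrow> nat \<Rightarrow> enat" where
  "cost A K T d =
     (if \<exists>n. level T d \<subseteq> position A K T ` {..n}
      then enat (LEAST n. level T d \<subseteq> position A K T ` {..n}) else \<infinity>)"

definition bounded_instances :: "nat \<Rightarrow> knowledge \<Rightarrow> knowledge" where
  "bounded_instances m K = {(T, d) \<in> K. d \<le> m}"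

definition overhead :: "algorithm \<Rightarrow> knowledge \<Rightarrow> nat \<Rightarrow> ennreal" where
  "overhead A K m =
     (if bounded_instances m K \<noteq> {}
      then SUP (T, d)\<in>bounded_instances m K. ennreal_of_enat (cost A K T d) / of_nat d
      else 0)"

definition knowledge_le :: "knowledge set \<Rightarrow> knowledge set \<Rightarrow> bool" (infix "\<lless>" 50) where
  "\<T>\<^sub>1 \<lless> \<T>\<^sub>2 \<longleftrightarrow> (\<forall>K\<^sub>1\<in>\<T>\<^sub>1. \<exists>K\<^sub>2\<in>\<T>\<^sub>2. K\<^sub>1 \<subseteq> K\<^sub>2)"

text \<open>
  The penalty is only defined for comparable knowledge types, hence the first conjunct.
\<close>

definition penalty_bigo :: "knowledge set \<Rightarrow> knowledge set \<Rightarrow> (nat \<Rightarrow> nat) \<Rightarrow> bool" where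
  "penalty_bigo \<T>\<^sub>2 \<T>\<^sub>1 f \<longleftrightarrow>
     \<T>\<^sub>1 \<lless> \<T>\<^sub>2 \<and>
     (\<exists>c::real. c > 0 \<and> (\<exists>A\<^sub>2. det_algorithm A\<^sub>2 \<and>
        (\<forall>A\<^sub>1. det_algorithm A\<^sub>1 \<longrightarrow> (\<forall>K\<^sub>2\<in>\<T>\<^sub>2. \<forall>m\<ge>1.
           overhead A\<^sub>2 K\<^sub>2 m \<le>
             ennreal c * of_nat (f m) * (SUP K\<^sub>1\<in>{K\<^sub>1\<in>\<T>\<^sub>1. K\<^sub>1 \<subseteq> K\<^sub>2}. overhead A\<^sub>1 K\<^sub>1 m)))))"

end

theory Submission
  imports Defs
begin

text \<open>Let \<open>e(d)\<close> be the number of nodes at depth \<open>1, \<dots>, d\<close>.  An agent that does not know the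
  distance and has overhead \<open>O\<close> at \<open>m \<ge> d\<close> must have visited all levels up to \<open>d\<close> by time
  \<open>O d\<close>, even if it knows the port numbers, so \<open>e(d) \<le> O d\<close>.  Conversely, the blind map determines \<open>e\<close>,
  and a depth-first search down to depth \<open>D\<close> takes \<open>2 e(D)\<close> moves whatever the port numbers are.
  Searching in phase \<open>j\<close> down to the greatest depth \<open>D\<close> with \<open>e(D) \<le> 2\<^sup>j\<close> therefore visits all nodes at
  depth \<open>d\<close> within \<open>8 e(d) \<le> 8 O d\<close> moves.\<close>

section \<open>Rooted structure of a tree\<close>

definition children :: "ptree \<Rightarrow> nat \<Rightarrow> nat set" where
  "children T v = {u \<in> nbrs T v. depth T u = Suc (depth T v)}"

definition parent :: "ptree \<Rightarrow> nat \<Rightarrow> nat" where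
  "parent T v = (THE w. adj T v w \<and> depth T v = Suc (depth T w))"

text \<open>The proper descendants of \<open>v\<close> at most \<open>r\<close> levels further down.
  The recursion through the children matches the order in which the tour enters subtrees.\<close>

primrec below :: "ptree \<Rightarrow> nat \<Rightarrow> nat \<Rightarrow> nat set" where
  "below T 0 v = {}"
| "below T (Suc r) v = (\<Union>u\<in>children T v. insert u (below T r u))"

lemma adj_sym: "adj T u v \<longleftrightarrow> adj T v u"
  by (simp add: adj_def insert_commute)

locale port_tree =
  fixes T :: ptree
  assumes tree: "is_tree T"
begin

lemma finite_nodes: "finite (nodes T)"
  and start_node: "start T \<in> nodes T"
  and acyclic: "\<not> has_cycle T"
  using tree by (auto simp: is_tree_def)

lemma adjD: "adj T u v \<Longrightarrow> u \<in> nodes T \<and> v \<in> nodes T \<and> u \<noteq> v"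
proof -
  assume "adj T u v"
  moreover have "edges T \<subseteq> {{u, v} |u v. u \<in> nodes T \<and> v \<in> nodes T \<and> u \<noteq> v}"
    using tree by (simp add: is_tree_def)
  ultimately obtain x y where "{u, v} = {x, y}" "x \<in> nodes T" "y \<in> nodes T" "x \<noteq> y"
    unfolding adj_def by blast
  then show ?thesis
    by (auto simp: doubleton_eq_iff)
qed

lemma finite_nbrs: "finite (nbrs T v)"
  by (rule finite_subset[OF _ finite_nodes]) (auto simp: nbrs_def dest: adjD)

lemma port_bij: "v \<in> nodes T \<Longrightarrow> bij_betw (port T v) (nbrs T v) {..<degree T v}"
  using tree by (auto simp: is_tree_def)

lemma port_less: "adj T v u \<Longrightarrow> port T v u < degree T v"
  using port_bij[of v] adjD[of v u] by (auto simp: bij_betw_def nbrs_def)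

lemma via_port_port: "adj T v u \<Longrightarrow> via_port T v (port T v u) = u"
  using port_bij[of v] adjD[of v u]
  by (auto simp: via_port_def bij_betw_def nbrs_def inj_on_def intro!: the_equality)

lemma port_via_port:
  assumes "v \<in> nodes T" "p < degree T v"
  shows "adj T v (via_port T v p)" "port T v (via_port T v p) = p"
proof -
  have "p \<in> port T v ` nbrs T v"
    using port_bij[OF assms(1)] assms(2) by (simp add: bij_betw_def)
  then obtain u where "adj T v u" "port T v u = p"
    by (auto simp: nbrs_def)
  then show "adj T v (via_port T v p)" "port T v (via_port T v p) = p"
    using via_port_port by auto
qed

lemma via_port_bij:
  assumes "v \<in> nodes T"
  shows "bij_betw (via_port T v) {..<degree T v} (nbrs T v)"
  using port_via_port[OF assms] via_port_port[of v] port_less[of v]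
  by (intro bij_betw_byWitness[where f' = "port T v"]) (auto simp: nbrs_def)

section \<open>Depth, parents and children\<close>

lemma depth_relpow: "v \<in> nodes T \<Longrightarrow> (adj T ^^ depth T v) (start T) v"
proof -
  assume "v \<in> nodes T"
  then have "(adj T)\<^sup>*\<^sup>* (start T) v"
    using tree start_node by (auto simp: is_tree_def)
  then obtain n where "(adj T ^^ n) (start T) v"
    using rtranclp_imp_relpowp by fast
  then show ?thesis
    unfolding depth_def by (rule LeastI)
qed

lemma depth_le: "(adj T ^^ n) (start T) v \<Longrightarrow> depth T v \<le> n"
  unfolding depth_def by (rule Least_le)

lemma depth_start [simp]: "depth T (start T) = 0"
  using depth_le[of 0 "start T"] by simp

lemma depth_0: "v \<in> nodes T \<Longrightarrow> depth T v = 0 \<Longrightarrow> v = start T"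
  using depth_relpow[of v] by simp

lemma depth_adj_le:
  assumes "adj T u v"
  shows "depth T v \<le> Suc (depth T u)"
proof -
  have "(adj T ^^ depth T u) (start T) u"
    using assms adjD depth_relpow by blast
  then have "(adj T ^^ Suc (depth T u)) (start T) v"
    using assms by auto
  then show ?thesis
    by (rule depth_le)
qed

lemma ex_parent:
  assumes "v \<in> nodes T" "depth T v = Suc n"
  shows "\<exists>w. adj T v w \<and> depth T w = n"
proof -
  have "(adj T ^^ Suc n) (start T) v"
    using depth_relpow[OF assms(1)] assms(2) by simp
  then obtain w where w: "(adj T ^^ n) (start T) w" "adj T w v"
    by auto
  have "depth T w = n"
    using depth_le[OF w(1)] depth_adj_le[OF w(2)] assms(2) by simp
  then show ?thesis
    using w(2) adj_sym by blast
qed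

text \<open>Climbing from both nodes until the two walks meet.\<close>

lemma same_depth_path:
  assumes "x \<in> nodes T" "y \<in> nodes T" "x \<noteq> y" "depth T x = n" "depth T y = n"
  shows "\<exists>p. length p \<ge> 3 \<and> distinct p \<and> successively (adj T) p \<and> hd p = x \<and> last p = y \<and>
    (\<forall>z\<in>set p. depth T z \<le> n)"
  using assms
proof (induction n arbitrary: x y)
  case 0
  then show ?case
    using depth_0 by auto
next
  case (Suc n)
  obtain x' where x': "adj T x x'" "depth T x' = n"
    using ex_parent Suc.prems by blast
  obtain y' where y': "adj T y y'" "depth T y' = n"
    using ex_parent Suc.prems by blast
  show ?case
  proof (cases "x' = y'")
    case True
    then show ?thesis
      using x' y' Suc.prems adjD adj_sym by (intro exI[of _ "[x, x', y]"]) auto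
  next
    case False
    obtain p where p: "length p \<ge> 3" "distinct p" "successively (adj T) p" "hd p = x'"
      "last p = y'" "\<forall>z\<in>set p. depth T z \<le> n"
      using Suc.IH[OF _ _ False] x' y' adjD by blast
    have "p \<noteq> []"
      using p(1) by auto
    moreover have "x \<notin> set p" "y \<notin> set p"
      using p(6) Suc.prems by auto
    ultimately show ?thesis
      using p x' y' Suc.prems adj_sym
      by (intro exI[of _ "x # p @ [y]"])
        (auto simp: successively_Cons successively_append_iff)
  qed
qed

text \<open>An edge between two nodes of equal depth would close the path of
  \<open>same_depth_path\<close> to a cycle.\<close>

lemma depth_adj_neq:
  assumes "adj T u v"
  shows "depth T u \<noteq> depth T v"
proof
  assume "depth T u = depth T v"
  then obtain p where "length p \<ge> 3" "distinct p" "successively (adj T) p" "hd p = u" "last p = v"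
    using same_depth_path[of u v] adjD[OF assms] by metis
  then show False
    using acyclic assms adj_sym unfolding has_cycle_def by blast
qed

text \<open>Two different parents have equal depth, so a path joins them without going deeper than
  they are. It avoids \<open>v\<close>, and adding \<open>v\<close> closes a cycle.\<close>

lemma parent_unique:
  assumes "adj T v x" "adj T v y" "depth T v = Suc (depth T x)" "depth T v = Suc (depth T y)"
  shows "x = y"
proof (rule ccontr)
  assume "x \<noteq> y"
  then obtain p where p: "length p \<ge> 3" "distinct p" "successively (adj T) p" "hd p = x"
    "last p = y" "\<forall>z\<in>set p. depth T z \<le> depth T x"
    using same_depth_path[of x y] assms adjD[OF assms(1)] adjD[OF assms(2)] by auto
  have "p \<noteq> []" "v \<notin> set p"
    using p assms by auto
  then have "length (v # p) \<ge> 3 \<and> distinct (v # p) \<and> successively (adj T) (v # p) \<and>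
      adj T (last (v # p)) (hd (v # p))"
    using p assms adj_sym by (auto simp: successively_Cons)
  then show False
    using acyclic unfolding has_cycle_def by blast
qed

lemma parent_eq: "adj T v w \<Longrightarrow> depth T v = Suc (depth T w) \<Longrightarrow> parent T v = w"
  unfolding parent_def by (rule the_equality) (use parent_unique in auto)

lemma childrenD:
  assumes "u \<in> children T v"
  shows "adj T v u" "adj T u v" "depth T u = Suc (depth T v)" "parent T u = v"
    "u \<in> nodes T" "v \<in> nodes T"
proof -
  show "adj T v u" "depth T u = Suc (depth T v)"
    using assms by (auto simp: children_def nbrs_def)
  then show "adj T u v" "parent T u = v" "u \<in> nodes T" "v \<in> nodes T"
    using adj_sym[of T u v] parent_eq[of u v] adjD[of v u] by simp_all
qed

lemma adj_cases: "adj T v u \<Longrightarrow> u \<in> children T v \<or> v \<in> children T u"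
  using depth_adj_le[of u v] depth_adj_le[of v u] depth_adj_neq[of u v] adj_sym[of T u v]
  by (auto simp: children_def nbrs_def)

text \<open>A neighbour that is not a child of \<open>v\<close> has \<open>v\<close> as its child,
  and then it is the unique parent \<open>w\<close>.\<close>

lemma children_of_child:
  assumes "v \<in> children T w"
  shows "children T v = nbrs T v - {w}"
proof -
  have "u \<in> children T v \<longleftrightarrow> u \<noteq> w" if "adj T v u" for u
  proof
    show "u \<noteq> w" if "u \<in> children T v"
      using childrenD(3)[OF assms] childrenD(3)[OF that] by auto
    show "u \<in> children T v" if "u \<noteq> w"
      using adj_cases[OF \<open>adj T v u\<close>] childrenD(4)[OF assms] childrenD(4)[of v u] that by blast
  qed
  then show ?thesis
    by (auto simp: nbrs_def children_def)
qed

lemma children_start: "children T (start T) = nbrs T (start T)"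
proof -
  have "u \<in> children T (start T)" if "adj T (start T) u" for u
    using adj_cases[OF that] childrenD(3)[of "start T" u] by auto
  then show ?thesis
    by (auto simp: nbrs_def children_def)
qed

section \<open>Bounded-depth subtrees\<close>

lemma finite_children: "finite (children T v)"
  using finite_nbrs by (auto simp: children_def)

lemma belowD:
  "x \<in> below T r v \<Longrightarrow> x \<in> nodes T \<and> (\<exists>k\<ge>1. k \<le> r \<and> depth T x = depth T v + k \<and> (parent T ^^ k) x = v)"
proof (induction r arbitrary: v)
  case (Suc r)
  then obtain u where u: "u \<in> children T v" "x = u \<or> x \<in> below T r u"
    by auto
  then show ?case
  proof (elim disjE)
    assume "x = u"
    then show ?thesis
      using childrenD[OF u(1)] by (auto intro!: exI[of _ 1])
  next
    assume "x \<in> below T r u"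
    then obtain k where "x \<in> nodes T" "k \<le> r" "depth T x = depth T u + k" "(parent T ^^ k) x = u"
      using Suc.IH by blast
    then show ?thesis
      using childrenD[OF u(1)] by (auto intro!: exI[of _ "Suc k"])
  qed
qed simp

lemma finite_below: "finite (below T r v)"
  by (rule finite_subset[OF _ finite_nodes]) (use belowD in blast)

text \<open>Subtrees of different children are disjoint, since climbing from any node to the depth
  of the child identifies the child.\<close>

lemma card_below_Suc: "card (below T (Suc r) v) = (\<Sum>u\<in>children T v. Suc (card (below T r u)))"
proof -
  have anc: "(parent T ^^ (depth T x - depth T u)) x = u" if "x \<in> insert u (below T r u)" for x u
    using that belowD by fastforce
  have "insert u (below T r u) \<inter> insert u' (below T r u') = {}"
    if "u \<in> children T v" "u' \<in> children T v" "u \<noteq> u'" for u u'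
    using anc[of _ u] anc[of _ u'] that childrenD(3)[of _ v] by fastforce
  then have "card (below T (Suc r) v) = (\<Sum>u\<in>children T v. card (insert u (below T r u)))"
    unfolding below.simps using finite_children finite_below
    by (intro card_UN_disjoint) auto
  also have "\<dots> = (\<Sum>u\<in>children T v. Suc (card (below T r u)))"
    using belowD finite_below by (intro sum.cong) (auto dest: belowD simp: card_insert_if)
  finally show ?thesis .
qed

text \<open>The recursion of \<open>below\<close> unfolds at the top; this extends the set at its
  lower end, which an induction on the depth of the node reached requires.\<close>

lemma below_step: "x \<in> insert v (below T r v) \<Longrightarrow> y \<in> children T x \<Longrightarrow> y \<in> below T (Suc r) v"
proof (induction r arbitrary: v)
  case (Suc r)
  show ?case
  proof (cases "x = v")
    case False
    then obtain u where "u \<in> children T v" "x \<in> insert u (below T r u)"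
      using Suc.prems(1) by auto
    then show ?thesis
      using Suc.IH[of u] Suc.prems(2) by (subst below.simps) blast
  qed (use Suc.prems in auto)
qed auto

lemma below_Suc_mono: "below T r v \<subseteq> below T (Suc r) v"
proof (induction r arbitrary: v)
  case (Suc r)
  show ?case
    unfolding below.simps(2)[of T r v] below.simps(2)[of T "Suc r" v]
    by (intro UN_mono insert_mono Suc.IH order_refl)
qed simp

lemma below_start: "below T r (start T) = {v \<in> nodes T. 1 \<le> depth T v \<and> depth T v \<le> r}"
proof
  show "below T r (start T) \<subseteq> {v \<in> nodes T. 1 \<le> depth T v \<and> depth T v \<le> r}"
    using belowD by fastforce
  have mono: "below T m v \<subseteq> below T n v" if "m \<le> n" for m n v
    using that below_Suc_mono by (rule lift_Suc_mono_le[of "\<lambda>r. below T r v", rotated])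
  have reach: "v \<in> insert (start T) (below T (depth T v) (start T))" if "v \<in> nodes T" "depth T v = n" for v n
    using that
  proof (induction n arbitrary: v)
    case (Suc n)
    obtain w where "adj T v w" "depth T w = n"
      using ex_parent Suc.prems by blast
    then have "v \<in> children T w"
      using Suc.prems adj_sym by (auto simp: children_def nbrs_def)
    then show ?case
      using Suc.IH[of w] \<open>depth T w = n\<close> Suc.prems childrenD below_step by (metis insert_iff)
  qed (use depth_0 in auto)
  show "{v \<in> nodes T. 1 \<le> depth T v \<and> depth T v \<le> r} \<subseteq> below T r (start T)"
    using reach mono by fastforce
qed

end

section \<open>Depth-bounded Euler tours\<close>

text \<open>The entry stack lists the ports towards the root along the path from the current node to the
  root, so its length is the current depth.\<close>

definition entry_stack :: "(nat \<times> nat \<times> nat) list \<Rightarrow> nat list" where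
  "entry_stack ms =
     foldl (\<lambda>s (p, q, \<delta>). if s \<noteq> [] \<and> p = hd s then tl s else q # s) [] ms"

text \<open>The value 0 for the empty history is also the scan port after a complete tour from the
  root, so a new phase begins exactly like the first one.\<close>

definition scan_port :: "(nat \<times> nat \<times> nat) list \<Rightarrow> nat" where
  "scan_port ms = (if ms = [] then 0 else case last ms of (p, q, \<delta>) \<Rightarrow> Suc q mod \<delta>)"

text \<open>Leaving every node by the port following the entry port traverses an Euler tour; turning back
  at depth \<open>L t\<close>, where \<open>t\<close> is the time, truncates it.  The final test only matters for
  histories that do not arise from a run.\<close>

definition tour :: "(nat \<Rightarrow> nat) \<Rightarrow> history \<Rightarrow> nat" where
  "tour L H =
     (let s = entry_stack (snd H);
          p = (if s \<noteq> [] \<and> L (length (snd H)) \<le> length s then hd s else scan_port (snd H))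
      in if p < current_degree H then p else 0)"

lemma tour_less: "current_degree H > 0 \<Longrightarrow> tour L H < current_degree H"
  by (simp add: tour_def Let_def)

text \<open>Scanning cyclically from any port meets every port exactly once: two indices below
  \<open>n\<close> with equal residues differ by a multiple of \<open>n\<close>.\<close>

lemma bij_betw_add_mod:
  fixes a n :: nat
  shows "bij_betw (\<lambda>i. (a + i) mod n) {..<n} {..<n}"
proof -
  have *: "i = j" if "i \<le> j" "j < n" "(a + i) mod n = (a + j) mod n" for i j
  proof -
    have "n dvd (a + j) - (a + i)"
      using that by (metis mod_eq_dvd_iff_nat add_left_mono)
    then show ?thesis
      using that by (auto dest: dvd_imp_le)
  qed
  have "inj_on (\<lambda>i. (a + i) mod n) {..<n}"
  proof (rule inj_onI)
    fix i j assume "i \<in> {..<n}" "j \<in> {..<n}" "(a + i) mod n = (a + j) mod n"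
    then show "i = j"
      using *[of i j] *[of j i] by (cases "i \<le> j") auto
  qed
  moreover have "(\<lambda>i. (a + i) mod n) ` {..<n} \<subseteq> {..<n}"
    by (cases "n = 0") auto
  ultimately show ?thesis
    by (simp add: bij_betw_def endo_inj_surj)
qed

section \<open>Correctness of the tour\<close>

locale tour_run = port_tree +
  fixes A :: algorithm and K :: knowledge and L :: "nat \<Rightarrow> nat"
  assumes tour_alg: "A K = tour L"
begin

text \<open>The part of the history that determines the tour: time, node, entry stack and next scan
  port. The clause on \<open>current_degree\<close> ensures that the range test in
  \<open>tour\<close> uses the true degree.\<close>

definition state :: "nat \<Rightarrow> nat \<Rightarrow> nat list \<Rightarrow> nat \<Rightarrow> bool" where
  "state t v s a \<longleftrightarrow> (\<exists>ms. run A K T t = (v, degree T (start T), ms) \<and> length ms = t \<and>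
     entry_stack ms = s \<and> scan_port ms = a \<and>
     current_degree (degree T (start T), ms) = degree T v)"

lemma state_0: "state 0 (start T) [] 0"
  by (simp add: state_def entry_stack_def scan_port_def current_degree_def)

lemma position_state: "state t v s a \<Longrightarrow> position A K T t = v"
  by (auto simp: state_def position_def)

lemma state_move:
  assumes "state t v s a" "p = (if s \<noteq> [] \<and> L t \<le> length s then hd s else a)" "p < degree T v"
    "u = via_port T v p"
  shows "state (Suc t) u (if s \<noteq> [] \<and> p = hd s then tl s else port T u v # s)
    (Suc (port T u v) mod degree T u)"
proof -
  let ?d = "degree T (start T)"
  obtain ms where ms: "run A K T t = (v, ?d, ms)" "length ms = t" "entry_stack ms = s"
    "scan_port ms = a" "current_degree (?d, ms) = degree T v"
    using assms(1) by (auto simp: state_def)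
  have "A K (?d, ms) = p"
    using ms assms(2,3) by (auto simp: tour_alg tour_def Let_def split: if_splits)
  then have "run A K T (Suc t) = (u, ?d, ms @ [(p, port T u v, degree T u)])"
    using ms assms(4) by (simp add: Let_def)
  moreover have "entry_stack (ms @ [(p, port T u v, degree T u)]) =
      (if s \<noteq> [] \<and> p = hd s then tl s else port T u v # s)"
    using ms(3) by (simp add: entry_stack_def)
  ultimately show ?thesis
    using ms(2) unfolding state_def
    by (intro exI[of _ "ms @ [(p, port T u v, degree T u)]"])
      (simp add: scan_port_def current_degree_def)
qed

text \<open>A move towards the root is recognised by its port being the head of the stack, so a
  downward move must use another port.\<close>

lemma state_down:
  assumes "state t v s (port T v u)" "adj T v u" "length s < L t" "s \<noteq> [] \<Longrightarrow> hd s \<noteq> port T v u"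
  shows "state (Suc t) u (port T u v # s) (Suc (port T u v) mod degree T u)"
  using state_move[OF assms(1), of "port T v u" u] assms port_less[OF assms(2)] via_port_port[OF assms(2)]
  by (auto split: if_splits)

text \<open>There are two causes for climbing: the scan has come round to the entry port, or the
  depth limit is reached.\<close>

lemma state_up:
  assumes "state t v (port T v u # s) a" "adj T v u" "a = port T v u \<or> L t \<le> Suc (length s)"
  shows "state (Suc t) u s (Suc (port T u v) mod degree T u)"
  using state_move[OF assms(1), of "port T v u" u] assms port_less[OF assms(2)] via_port_port[OF assms(2)]
  by (auto split: if_splits)

text \<open>The induction claim for a subtree just entered from \<open>w\<close>, with
  \<open>r\<close> levels left: each edge below \<open>v\<close> is traversed twice, and one more
  move leads back to \<open>w\<close>, where the scan resumes after the port to \<open>v\<close>.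
  The limit must hold up to the time at which that last move is chosen.\<close>

definition returns :: "nat \<Rightarrow> bool" where
  "returns r \<longleftrightarrow> (\<forall>v w s t. v \<in> children T w \<longrightarrow> length s = depth T w \<longrightarrow>
     (\<forall>t'\<in>{t..t + 2 * card (below T r v)}. L t' = depth T v + r) \<longrightarrow>
     state t v (port T v w # s) (Suc (port T v w) mod degree T v) \<longrightarrow>
     state (t + 2 * card (below T r v) + 1) w s (Suc (port T w v) mod degree T w) \<and>
     insert v (below T r v) \<subseteq> position A K T ` {t..t + 2 * card (below T r v) + 1})"

text \<open>Induction on the number \<open>k\<close> of ports scanned at \<open>v\<close>. The time
  \<open>\<tau> k\<close> counts, per child, the edge to it in both directions and the tour of its
  subtree.\<close>

lemma scan_ports:
  fixes k r v a :: nat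
  defines "u \<equiv> \<lambda>i. via_port T v ((a + i) mod degree T v)"
  defines "\<tau> \<equiv> \<lambda>k. \<Sum>i<k. 2 * Suc (card (below T r (u i)))"
  assumes r: "returns r" and v: "v \<in> nodes T" "length s = depth T v"
    and st: "state t v s a" "a mod degree T v = a"
    and ch: "\<And>i. i < k \<Longrightarrow> u i \<in> children T v"
    and hd: "\<And>i. i < k \<Longrightarrow> s \<noteq> [] \<Longrightarrow> hd s \<noteq> (a + i) mod degree T v"
    and L: "\<And>t'. t \<le> t' \<Longrightarrow> t' < t + \<tau> k \<Longrightarrow> L t' = depth T v + Suc r"
  shows "state (t + \<tau> k) v s ((a + k) mod degree T v) \<and>
    (\<Union>i<k. insert (u i) (below T r (u i))) \<subseteq> position A K T ` {t..t + \<tau> k}"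
  using ch hd L
proof (induction k)
  case 0
  then show ?case
    using st by (simp add: \<tau>_def)
next
  case (Suc k)
  let ?c = "card (below T r (u k))" and ?t = "t + \<tau> k"
  have \<tau>: "\<tau> (Suc k) = \<tau> k + 2 * ?c + 2"
    by (simp add: \<tau>_def)
  have IH: "state ?t v s ((a + k) mod degree T v)"
    "(\<Union>i<k. insert (u i) (below T r (u i))) \<subseteq> position A K T ` {t..?t}"
    using Suc.IH Suc.prems \<tau> by auto
  have child: "u k \<in> children T v"
    using Suc.prems(1) by simp
  have "degree T v > 0"
    using port_less[OF childrenD(1)[OF child]] by simp
  then have port: "port T v (u k) = (a + k) mod degree T v"
    using port_via_port(2)[OF v(1)] by (simp add: u_def)
  have "state (Suc ?t) (u k) (port T (u k) v # s) (Suc (port T (u k) v) mod degree T (u k))"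
    using IH(1) Suc.prems(2)[of k] Suc.prems(3)[of ?t] childrenD(1)[OF child] v(2) port \<tau>
    by (intro state_down) auto
  moreover have "L t' = depth T (u k) + r" if "t' \<in> {Suc ?t..Suc ?t + 2 * ?c}" for t'
    using that Suc.prems(3)[of t'] childrenD(3)[OF child] \<tau> by auto
  ultimately have *: "state (Suc ?t + 2 * ?c + 1) v s (Suc (port T v (u k)) mod degree T v)"
    "insert (u k) (below T r (u k)) \<subseteq> position A K T ` {Suc ?t..Suc ?t + 2 * ?c + 1}"
    using r child v(2) unfolding returns_def by blast+
  \<comment> \<open>One move into the child, then the \<open>2 * ?c + 1\<close> moves of
    \<open>returns\<close>.\<close>
  have time: "Suc ?t + 2 * ?c + 1 = t + \<tau> (Suc k)"
    using \<tau> by simp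
  have "position A K T ` {Suc ?t..Suc ?t + 2 * ?c + 1} \<subseteq> position A K T ` {t..t + \<tau> (Suc k)}"
    "position A K T ` {t..?t} \<subseteq> position A K T ` {t..t + \<tau> (Suc k)}"
    using \<tau> by (intro image_mono; simp)+
  then have "(\<Union>i<Suc k. insert (u i) (below T r (u i))) \<subseteq> position A K T ` {t..t + \<tau> (Suc k)}"
    unfolding lessThan_Suc UN_insert by (intro Un_least order_trans[OF *(2)] order_trans[OF IH(2)])
  moreover have "Suc (port T v (u k)) mod degree T v = (a + Suc k) mod degree T v"
    by (simp only: port mod_Suc_eq add_Suc_right)
  ultimately show ?case
    using *(1) unfolding time by metis
qed

text \<open>When the scanned ports match the children bijectively, the elapsed time becomes a sum
  over children and equals twice the size of \<open>below\<close>. Away from the root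
  \<open>k\<close> is the degree minus one, at the root the full degree.\<close>

lemma scan_children:
  assumes r: "returns r" and v: "v \<in> nodes T" "length s = depth T v"
    and st: "state t v s a" "a mod degree T v = a"
    and bij: "bij_betw (\<lambda>i. via_port T v ((a + i) mod degree T v)) {..<k} (children T v)"
    and hd: "\<And>i. i < k \<Longrightarrow> s \<noteq> [] \<Longrightarrow> hd s \<noteq> (a + i) mod degree T v"
    and L: "\<And>t'. t \<le> t' \<Longrightarrow> t' < t + 2 * card (below T (Suc r) v) \<Longrightarrow> L t' = depth T v + Suc r"
  shows "state (t + 2 * card (below T (Suc r) v)) v s ((a + k) mod degree T v)"
    "below T (Suc r) v \<subseteq> position A K T ` {t..t + 2 * card (below T (Suc r) v)}"
proof -
  let ?u = "\<lambda>i. via_port T v ((a + i) mod degree T v)"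
  have im: "?u ` {..<k} = children T v"
    using bij by (simp add: bij_betw_def)
  have "(\<Sum>i<k. 2 * Suc (card (below T r (?u i)))) = (\<Sum>u\<in>children T v. 2 * Suc (card (below T r u)))"
    using bij by (rule sum.reindex_bij_betw)
  also have "\<dots> = 2 * card (below T (Suc r) v)"
    by (simp only: card_below_Suc sum_distrib_left)
  finally have \<tau>: "(\<Sum>i<k. 2 * Suc (card (below T r (?u i)))) = 2 * card (below T (Suc r) v)" .
  have "(\<Union>i<k. insert (?u i) (below T r (?u i))) = below T (Suc r) v"
    unfolding below.simps im[symmetric] by blast
  moreover have "?u i \<in> children T v" if "i < k" for i
    using im that by blast
  ultimately show "state (t + 2 * card (below T (Suc r) v)) v s ((a + k) mod degree T v)"
    "below T (Suc r) v \<subseteq> position A K T ` {t..t + 2 * card (below T (Suc r) v)}"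
    using scan_ports[OF r v st, of k, OF _ hd, unfolded \<tau>, OF _ _ _ L] by simp_all
qed

lemma returns: "returns r"
proof (induction r)
  case 0
  show ?case
    unfolding returns_def
  proof (intro allI impI)
    fix v w s t
    assume *: "v \<in> children T w" "length s = depth T w"
      "\<forall>t'\<in>{t..t + 2 * card (below T 0 v)}. L t' = depth T v + 0"
      "state t v (port T v w # s) (Suc (port T v w) mod degree T v)"
    \<comment> \<open>The stack has length \<open>Suc (depth T w) = depth T v\<close>, which is the
      limit, so the tour turns back at once.\<close>
    have "state (Suc t) w s (Suc (port T w v) mod degree T w)"
      using * childrenD[OF *(1)] by (intro state_up) auto
    moreover have "v \<in> position A K T ` {t..Suc t}"
      using position_state[OF *(4)] by force
    ultimately show "state (t + 2 * card (below T 0 v) + 1) w s (Suc (port T w v) mod degree T w) \<and>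
     insert v (below T 0 v) \<subseteq> position A K T ` {t..t + 2 * card (below T 0 v) + 1}"
      by simp
  qed
next
  case (Suc r)
  show ?case
    unfolding returns_def
  proof (intro allI impI)
    fix v w s t
    let ?c = "card (below T (Suc r) v)"
    let ?n = "degree T v" and ?q = "port T v w"
    let ?s = "?q # s" and ?a = "Suc ?q mod ?n"
    assume *: "v \<in> children T w" "length s = depth T w"
      "\<forall>t'\<in>{t..t + 2 * ?c}. L t' = depth T v + Suc r"
      "state t v ?s ?a"
    note w = childrenD[OF *(1)]
    have q: "?q < ?n"
      by (rule port_less[OF w(2)])
    let ?f = "\<lambda>i. (?a + i) mod ?n"
    \<comment> \<open>The scan starts just after the entry port, so it comes back to that port after
      all the others.\<close>
    have last: "?f (?n - 1) = ?q"
    proof -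
      have "?f (?n - 1) = (Suc ?q + (?n - 1)) mod ?n"
        by (rule mod_add_left_eq)
      also have "Suc ?q + (?n - 1) = ?q + ?n"
        using q by simp
      finally show ?thesis
        using q by simp
    qed
    have split: "{..<?n - 1} = {..<?n} - {?n - 1}"
      using q by auto
    \<comment> \<open>Dropping the last index of the full cycle removes exactly the port to the
      parent.\<close>
    have f: "bij_betw ?f {..<?n - 1} ({..<?n} - {?q})"
      using bij_betw_DiffI[OF bij_betw_add_mod[of ?a ?n], of "{?n - 1}" "{?q}"] last q
      unfolding split by (simp add: bij_betw_def)
    moreover have "bij_betw (via_port T v) ({..<?n} - {?q}) (nbrs T v - {w})"
      using bij_betw_DiffI[OF via_port_bij[OF w(5)], of "{?q}" "{w}"] q via_port_port[OF w(2)] w(2)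
      by (simp add: bij_betw_def nbrs_def)
    ultimately have "bij_betw (\<lambda>i. via_port T v (?f i)) {..<?n - 1} (children T v)"
      unfolding children_of_child[OF *(1)] by (auto dest: bij_betw_trans simp: comp_def)
    moreover have "?q \<noteq> ?f i" if "i < ?n - 1" for i
      using f that by (auto simp: bij_betw_def)
    ultimately have "state (t + 2 * ?c) v ?s (?f (?n - 1))"
      and vis: "below T (Suc r) v \<subseteq> position A K T ` {t..t + 2 * ?c}"
      using scan_children[OF Suc w(5) _ *(4), of "?n - 1"] * w by auto
    then have "state (Suc (t + 2 * ?c)) w s (Suc (port T w v) mod degree T w)"
      using last w by (intro state_up) auto
    moreover have "v \<in> position A K T ` {t..t + 2 * ?c}"
      using position_state[OF *(4)] by force
    ultimately show "state (t + 2 * ?c + 1) w s (Suc (port T w v) mod degree T w) \<and>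
      insert v (below T (Suc r) v) \<subseteq> position A K T ` {t..t + 2 * ?c + 1}"
      using vis by (auto simp del: below.simps)
  qed
qed

text \<open>All ports of the root lead to children, so the scan makes a full turn and ends at port 0
  again. The state is restored and tours can be concatenated.\<close>

lemma root_tour:
  assumes "state t (start T) [] 0"
    and L: "\<And>t'. t \<le> t' \<Longrightarrow> t' < t + 2 * card (below T D (start T)) \<Longrightarrow> L t' = D"
  shows "state (t + 2 * card (below T D (start T))) (start T) [] 0"
    "below T D (start T) \<subseteq> position A K T ` {t..t + 2 * card (below T D (start T))}"
proof -
  have "state (t + 2 * card (below T D (start T))) (start T) [] 0 \<and>
    below T D (start T) \<subseteq> position A K T ` {t..t + 2 * card (below T D (start T))}"
  proof (cases D)
    case 0
    then show ?thesis
      using assms by simp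
  next
    case (Suc r)
    let ?n = "degree T (start T)"
    have "bij_betw (\<lambda>i. via_port T (start T) ((0 + i) mod ?n)) {..<?n} (children T (start T))"
      using bij_betw_trans[OF bij_betw_add_mod via_port_bij[OF start_node]]
      unfolding children_start comp_def .
    from scan_children[OF returns start_node _ assms(1) _ this, of r] show ?thesis
      using L unfolding Suc by auto
  qed
  then show "state (t + 2 * card (below T D (start T))) (start T) [] 0"
    "below T D (start T) \<subseteq> position A K T ` {t..t + 2 * card (below T D (start T))}"
    by auto
qed

end

section \<open>Doubling the exploration budget\<close>

text \<open>The quantity \<open>e(D)\<close>. It also counts the edges down to depth
  \<open>D\<close>, one from each such node to its parent, whence the tour length
  \<open>2 e(D)\<close>.\<close>

definition ball_size :: "ptree \<Rightarrow> nat \<Rightarrow> nat" where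
  "ball_size T D = card {v \<in> nodes T. 1 \<le> depth T v \<and> depth T v \<le> D}"

definition phase_depth :: "(nat \<Rightarrow> nat) \<Rightarrow> nat \<Rightarrow> nat \<Rightarrow> nat" where
  "phase_depth e h j = Max {D. D \<le> h \<and> e D \<le> 2 ^ j}"

definition phase_start :: "(nat \<Rightarrow> nat) \<Rightarrow> nat \<Rightarrow> nat \<Rightarrow> nat" where
  "phase_start e h j = (\<Sum>i<j. 2 * e (phase_depth e h i))"

text \<open>The least \<open>j\<close> is the phase containing time \<open>t\<close>; phases of
  length zero contain no time and are skipped.\<close>

definition depth_limit :: "(nat \<Rightarrow> nat) \<Rightarrow> nat \<Rightarrow> nat \<Rightarrow> nat" where
  "depth_limit e h t = phase_depth e h (LEAST j. t < phase_start e h (Suc j))"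

lemma phase_depth:
  assumes "e 0 = 0"
  shows "e (phase_depth e h j) \<le> 2 ^ j"
    and "D \<le> h \<Longrightarrow> e D \<le> 2 ^ j \<Longrightarrow> D \<le> phase_depth e h j"
proof -
  have "finite {D. D \<le> h \<and> e D \<le> 2 ^ j}"
    by (rule finite_subset[of _ "{..h}"]) auto
  moreover have "0 \<in> {D. D \<le> h \<and> e D \<le> 2 ^ j}"
    using assms by simp
  ultimately show "e (phase_depth e h j) \<le> 2 ^ j"
    and "D \<le> h \<Longrightarrow> e D \<le> 2 ^ j \<Longrightarrow> D \<le> phase_depth e h j"
    unfolding phase_depth_def using Max_in[of "{D. D \<le> h \<and> e D \<le> 2 ^ j}"] by auto
qed

lemma phase_start_Suc: "phase_start e h (Suc j) = phase_start e h j + 2 * e (phase_depth e h j)"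
  by (simp add: phase_start_def)

text \<open>Phase \<open>i\<close> takes at most \<open>2 * 2 ^ i\<close> moves, and these bounds
  form a geometric series.\<close>

lemma phase_start_le:
  assumes "e 0 = 0"
  shows "phase_start e h j \<le> 2 * 2 ^ j"
proof (induction j)
  case 0
  then show ?case
    by (simp add: phase_start_def)
next
  case (Suc j)
  then show ?case
    using phase_depth(1)[of e, OF assms, of h j] by (simp add: phase_start_Suc)
qed

lemma depth_limit_eq:
  assumes "phase_start e h j \<le> t" "t < phase_start e h (Suc j)"
  shows "depth_limit e h t = phase_depth e h j"
proof -
  have mono: "phase_start e h i \<le> phase_start e h k" if "i \<le> k" for i k
    using that by (rule lift_Suc_mono_le[rotated]) (simp add: phase_start_Suc)
  have "j \<le> i" if "t < phase_start e h (Suc i)" for i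
  proof (rule ccontr)
    assume "\<not> j \<le> i"
    then show False
      using mono[of "Suc i" j] assms(1) that by simp
  qed
  then have "(LEAST j. t < phase_start e h (Suc j)) = j"
    using assms(2) by (intro Least_equality)
  then show ?thesis
    by (simp add: depth_limit_def)
qed

section \<open>Cost of the doubling tour\<close>

lemma level_subset_ball: "1 \<le> d \<Longrightarrow> level T d \<subseteq> {v \<in> nodes T. 1 \<le> depth T v \<and> depth T v \<le> d}"
  by (auto simp: level_def)

lemma cost_le: "level T d \<subseteq> position A K T ` {..n} \<Longrightarrow> cost A K T d \<le> enat n"
  by (auto simp: cost_def intro: Least_le)

lemma (in port_tree) cost_doubling_tour:
  assumes A: "A K = tour (depth_limit (ball_size T) (height T))"
    and d: "1 \<le> d" "d \<le> height T"
  shows "cost A K T d \<le> enat (8 * ball_size T d)"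
proof -
  let ?e = "ball_size T" and ?h = "height T"
  interpret tour_run T A K "depth_limit ?e ?h"
    by unfold_locales (rule A)
  have card: "card (below T D (start T)) = ?e D" for D
    by (simp only: below_start ball_size_def)
  have e0: "?e 0 = 0"
    using card[of 0] by simp
  let ?s = "phase_start ?e ?h"
  have phase: "state (?s (Suc j)) (start T) [] 0"
    "below T (phase_depth ?e ?h j) (start T) \<subseteq> position A K T ` {?s j..?s (Suc j)}"
    if "state (?s j) (start T) [] 0" for j
    using root_tour[OF that, of "phase_depth ?e ?h j"] depth_limit_eq[of ?e ?h j]
    by (simp_all only: card phase_start_Suc)
  have start: "state (?s j) (start T) [] 0" for j
    by (induction j) (use state_0 phase(1) in \<open>auto simp: phase_start_def[of _ _ 0]\<close>)
  show ?thesis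
  proof (cases "?e d = 0")
    \<comment> \<open>Separated because the bound \<open>2 ^ j \<le> 2 * ?e d\<close> used in the
      other case fails when \<open>?e d = 0\<close>.\<close>
    case True
    then have "{v \<in> nodes T. 1 \<le> depth T v \<and> depth T v \<le> d} = {}"
      using finite_nodes unfolding ball_size_def by (subst (asm) card_eq_0_iff) auto
    then have "level T d = {}"
      using level_subset_ball[OF d(1), of T] by blast
    then show ?thesis
      by (intro cost_le) simp
  next
    case False
    define j where "j = (LEAST j. ?e d \<le> 2 ^ j)"
    have "?e d \<le> 2 ^ ?e d"
      using less_exp[of "?e d"] by simp
    then have j: "?e d \<le> 2 ^ j"
      unfolding j_def by (rule LeastI)
    \<comment> \<open>By minimality of \<open>j\<close> the budget overshoots \<open>?e d\<close> by
      at most a factor of two.\<close>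
    have "2 ^ j \<le> 2 * ?e d"
    proof (cases j)
      case 0
      then show ?thesis
        using False by simp
    next
      case (Suc i)
      then have "\<not> ?e d \<le> 2 ^ i"
        using not_less_Least[of i "\<lambda>j. ?e d \<le> 2 ^ j"] unfolding j_def by simp
      then show ?thesis
        using Suc by simp
    qed
    \<comment> \<open>Phase \<open>j\<close> ends by time
      \<open>2 * 2 ^ Suc j = 4 * 2 ^ j\<close>.\<close>
    then have time: "?s (Suc j) \<le> 8 * ?e d"
      using phase_start_le[of ?e, OF e0, of ?h "Suc j"] by simp
    have "d \<le> phase_depth ?e ?h j"
      using phase_depth(2)[of ?e, OF e0] d(2) j by blast
    then have "level T d \<subseteq> below T (phase_depth ?e ?h j) (start T)"
      using d(1) by (auto simp: below_start level_def)
    also have "\<dots> \<subseteq> position A K T ` {?s j..?s (Suc j)}"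
      by (rule phase(2)[OF start])
    also have "\<dots> \<subseteq> position A K T ` {..8 * ?e d}"
      using time by (intro image_mono) auto
    finally show ?thesis
      by (rule cost_le)
  qed
qed

section \<open>Lower bound for an algorithm knowing the ports\<close>

text \<open>The knowledge is the same for every distance, so one single run must meet the cost
  bounds of all levels up to \<open>d\<close>.\<close>

lemma (in port_tree) ball_size_le_overhead:
  assumes K: "K = {(T, d) |d. 1 \<le> d \<and> d \<le> height T}"
    and d: "1 \<le> d" "d \<le> height T" "d \<le> m"
  shows "of_nat (ball_size T d) \<le> overhead A K m * of_nat d"
proof (cases "overhead A K m * of_nat d = top")
  case False
  let ?b = "overhead A K m * of_nat d"
  have "\<exists>n. level T i \<subseteq> position A K T ` {..n} \<and> of_nat n \<le> ?b" if i: "i \<in> {1..d}" for i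
  proof -
    have "(T, i) \<in> bounded_instances m K"
      using i d by (auto simp: bounded_instances_def K)
    then have "ennreal_of_enat (cost A K T i) / of_nat i \<le> overhead A K m"
      unfolding overhead_def by (auto intro!: SUP_upper2[of "(T, i)"])
    \<comment> \<open>Level \<open>i\<close> is finished within
      \<open>overhead A K m * of_nat i\<close> moves, and \<open>i \<le> d\<close>.\<close>
    then have "ennreal_of_enat (cost A K T i) / of_nat i * of_nat i \<le> ?b"
      using i by (intro mult_mono) auto
    then have le: "ennreal_of_enat (cost A K T i) \<le> ?b"
      using i by (simp add: ennreal_divide_times of_nat_less_top)
    then have fin: "cost A K T i \<noteq> \<infinity>"
      using False by (metis ennreal_of_enat_infty infinity_ennreal_def top_unique)
    then have ex: "\<exists>n. level T i \<subseteq> position A K T ` {..n}"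
      by (auto simp: cost_def split: if_splits)
    define n where "n = (LEAST n. level T i \<subseteq> position A K T ` {..n})"
    have "level T i \<subseteq> position A K T ` {..n}"
      unfolding n_def using ex by (rule LeastI_ex)
    moreover have "cost A K T i = enat n"
      using ex by (simp add: cost_def n_def)
    ultimately show ?thesis
      using le by auto
  qed
  then obtain f where f: "\<And>i. i \<in> {1..d} \<Longrightarrow> level T i \<subseteq> position A K T ` {..f i} \<and> of_nat (f i) \<le> ?b"
    by metis
  define n where "n = Max (f ` {1..d})"
  have "n \<in> f ` {1..d}"
    unfolding n_def using d(1) by (intro Max_in) auto
  then have n: "of_nat n \<le> ?b"
    using f by auto
  let ?B = "{v \<in> nodes T. 1 \<le> depth T v \<and> depth T v \<le> d}"
  have "?B \<subseteq> position A K T ` {..n}"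
  proof
    fix v assume v: "v \<in> ?B"
    then have "v \<in> position A K T ` {..f (depth T v)}"
      using f[of "depth T v"] by (auto simp: level_def)
    moreover have "f (depth T v) \<le> n"
      unfolding n_def using v by (intro Max_ge) auto
    ultimately show "v \<in> position A K T ` {..n}"
      by auto
  qed
  \<comment> \<open>After \<open>n\<close> moves at most \<open>n + 1\<close> nodes are visited.
    Counting the start among them gives \<open>ball_size T d \<le> n\<close> without an additive
    loss.\<close>
  moreover have "start T \<in> position A K T ` {..n}"
    by (rule image_eqI[of _ _ 0]) (auto simp: position_def)
  ultimately have "card (insert (start T) ?B) \<le> card (position A K T ` {..n})"
    by (intro card_mono) auto
  also have "\<dots> \<le> Suc n"
    using card_image_le[of "{..n}" "position A K T"] by simp
  also have "card (insert (start T) ?B) = Suc (ball_size T d)"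
    using finite_nodes by (simp add: ball_size_def)
  finally have "ball_size T d \<le> n"
    by simp
  then show ?thesis
    using n order_trans by (metis of_nat_le_iff)
qed simp

section \<open>Comparison of the overheads\<close>

lemma port_reassignments_invariant:
  assumes "T' \<in> port_reassignments T"
  shows "height T' = height T" "ball_size T' = ball_size T"
proof -
  have "adj T' = adj T" "start T' = start T" "nodes T' = nodes T"
    using assms by (auto simp: port_reassignments_def adj_def fun_eq_iff)
  moreover from this have "depth T' = depth T"
    by (simp add: depth_def[abs_def])
  ultimately show "height T' = height T" "ball_size T' = ball_size T"
    by (simp_all add: height_def ball_size_def fun_eq_iff)
qed

text \<open>Any instance in \<open>K\<close> may represent the blind map, as height and ball sizes
  are the same for all port reassignments.\<close>

definition doubling_tour :: algorithm where
  "doubling_tour K = (let T = fst (SOME x. x \<in> K) in tour (depth_limit (ball_size T) (height T)))"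

lemma overhead_doubling_tour:
  assumes "K = {(T', d) |T' d. T' \<in> port_reassignments T \<and> 1 \<le> d \<and> d \<le> height T}"
  shows "overhead doubling_tour K m \<le> 8 * (SUP K\<^sub>1\<in>{K\<^sub>1\<in>comp_nodist. K\<^sub>1 \<subseteq> K}. overhead A K\<^sub>1 m)"
    (is "_ \<le> 8 * ?S")
proof -
  have "ennreal_of_enat (cost doubling_tour K T' d) / of_nat d \<le> 8 * ?S"
    if "(T', d) \<in> bounded_instances m K" for T' d
  proof -
    have *: "T' \<in> port_reassignments T" "1 \<le> d" "d \<le> height T'" "d \<le> m" "(T', d) \<in> K"
      using that port_reassignments_invariant(1) by (auto simp: bounded_instances_def assms)
    interpret port_tree T'
      using *(1) by unfold_locales (simp add: port_reassignments_def)
    have "(SOME x. x \<in> K) \<in> K"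
      using *(5) by (rule someI)
    then have "fst (SOME x. x \<in> K) \<in> port_reassignments T"
      by (auto simp: assms)
    then have "doubling_tour K = tour (depth_limit (ball_size T') (height T'))"
      using port_reassignments_invariant *(1) by (simp add: doubling_tour_def Let_def)
    then have "cost doubling_tour K T' d \<le> enat (8 * ball_size T' d)"
      using *(2,3) by (rule cost_doubling_tour)
    then have "ennreal_of_enat (cost doubling_tour K T' d) \<le> of_nat (8 * ball_size T' d)"
      by (metis ennreal_of_enat_enat ennreal_of_enat_le_iff)
    also have "\<dots> = 8 * of_nat (ball_size T' d)"
      by simp
    also have "\<dots> \<le> 8 * (overhead A {(T', d) |d. 1 \<le> d \<and> d \<le> height T'} m * of_nat d)"
      using ball_size_le_overhead[OF refl *(2-4)] by (intro mult_left_mono) auto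
    also have "\<dots> \<le> 8 * (?S * of_nat d)"
    proof (intro mult_left_mono mult_right_mono SUP_upper)
      \<comment> \<open>The competitor is taken with complete knowledge of the very tree
        \<open>T'\<close> being explored, one of the knowledges in the supremum.\<close>
      show "{(T', d) |d. 1 \<le> d \<and> d \<le> height T'} \<in> {K\<^sub>1\<in>comp_nodist. K\<^sub>1 \<subseteq> K}"
        using tree *(1)
        unfolding comp_nodist_def assms port_reassignments_invariant(1)[OF *(1), symmetric]
        by blast
    qed auto
    finally show ?thesis
      using *(2) by (intro divide_le_posI_ennreal) (auto simp: mult_ac)
  qed
  then show ?thesis
    unfolding overhead_def[of doubling_tour] by (auto intro!: SUP_least)
qed

theorem theorem2p4: "penalty_bigo blind_nodist comp_nodist (\<lambda>_. 1)"
  unfolding penalty_bigo_def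
proof (intro conjI exI[of _ "8::real"] exI[of _ doubling_tour] allI impI ballI)
  show "comp_nodist \<lless> blind_nodist"
    unfolding knowledge_le_def
  proof
    fix K assume "K \<in> comp_nodist"
    then obtain T where T: "is_tree T" "K = {(T, d) |d. 1 \<le> d \<and> d \<le> height T}"
      by (auto simp: comp_nodist_def)
    let ?K = "{(T', d) |T' d. T' \<in> port_reassignments T \<and> 1 \<le> d \<and> d \<le> height T}"
    \<comment> \<open>Every tree is a port reassignment of itself.\<close>
    have "?K \<in> blind_nodist" "K \<subseteq> ?K"
      using T by (auto simp: blind_nodist_def port_reassignments_def)
    then show "\<exists>K\<^sub>2\<in>blind_nodist. K \<subseteq> K\<^sub>2"
      by blast
  qed
  show "det_algorithm doubling_tour"
    by (auto simp: det_algorithm_def doubling_tour_def Let_def intro: tour_less)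
  fix A K and m :: nat assume "K \<in> blind_nodist"
  then obtain T where T: "is_tree T"
    "K = {(T', d) |T' d. T' \<in> port_reassignments T \<and> 1 \<le> d \<and> d \<le> height T}"
    by (auto simp: blind_nodist_def)
  show "overhead doubling_tour K m
    \<le> ennreal 8 * of_nat 1 * (SUP K\<^sub>1\<in>{K\<^sub>1\<in>comp_nodist. K\<^sub>1 \<subseteq> K}. overhead A K\<^sub>1 m)"
    using overhead_doubling_tour[OF T(2)] by simp
qed simp

end
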